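(* Let $x$ be a $\lambda$-Martin-L\"of random real in $[0,1]$, let $b \geq 2$ be an integer, and let $p_0, \dotsc, p_{b-1}$ be positive rational numbers summing to $1$, with $p_i = a_i/b_i$ in lowest terms. Let $d = \mathrm{lcm}(b_0, \dotsc, b_{b-1})$, let $g$ be the base-$b$ block of length $d$ consisting of $p_0 d$ copies of $0$, then $p_1 d$ copies of $1$, \dots, then $p_{b-1}d$ copies of $b-1$, and define $\beta \in b^{\omega}$ by $\beta[k] = g[(x)_d[k]]$ for all $k$, where $(x)_d$ is the base-$d$ digit sequence of $x$. Then $\beta$ is Bernoulli random with respect to $p_0, \dotsc, p_{b-1}$, i.e. $\beta$ is $\mu_{\bar{p}}$-Martin-L\"of random.
   Context: For a real $x$ and base $B$, $(x)_B$ is the base-$B$ digit sequence of $x$ with infinitely many digits different from $B-1$, indexed from $0$. $\lambda$ is Lebesgue measure (on $[0,1]$, equivalently the uniform product measure on $B^{\omega}$ for any base $B$). The Bernoulli measure $\mu_{\bar{p}}$ on $b^{\omega}$ is the Borel probability measure with $\mu_{\bar{p}}(\{\text{sequences extending }\sigma\}) = \prod_{j=0}^{\mathrm{len}(\sigma)-1} p_{\sigma[j]}$ for each finite block $\sigma$. For a measure $\mu$, a $\mu$-Martin-L\"of test is a uniformly computably enumerable sequence $(\mathcal{U}_i)_{i\in\omega}$ of effectively open sets with $\mu(\mathcal{U}_i)\le 2^{-i}$; a point is $\mu$-Martin-L\"of random if it lies outside $\bigcap_i \mathcal{U}_i$ for every such test. *)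

theory Defs
  imports "HOL-Probability.Probability" "HOL-Library.Nat_Bijection" "HOL-Library.Countable"
begin

section \<open>Partial recursive functions and computably enumerable sets\<close>

text \<open>
  A partial function of arity \<open>k\<close> is modelled as a function \<open>nat list \<Rightarrow> nat option\<close> of which
  only the values on lists of length \<open>k\<close> matter.
\<close>

definition pr_comp ::
  "(nat list \<Rightarrow> nat option) \<Rightarrow> (nat list \<Rightarrow> nat option) list \<Rightarrow> nat list \<Rightarrow> nat option" where
  "pr_comp f gs xs =
     (if \<forall>g\<in>set gs. g xs \<noteq> None then f (map (\<lambda>g. the (g xs)) gs) else None)"

definition pr_primrec ::
  "(nat list \<Rightarrow> nat option) \<Rightarrow> (nat list \<Rightarrow> nat option) \<Rightarrow> nat list \<Rightarrow> nat option" where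
  "pr_primrec f g xs =
     rec_nat (f (tl xs)) (\<lambda>m r. Option.bind r (\<lambda>v. g (m # v # tl xs))) (hd xs)"

text \<open>Minimization is undefined if some value before the first zero is undefined.\<close>

definition pr_min :: "(nat list \<Rightarrow> nat option) \<Rightarrow> nat list \<Rightarrow> nat option" where
  "pr_min f xs =
     (let P = (\<lambda>n. f (n # xs) = Some 0 \<and> (\<forall>m<n. \<exists>v. f (m # xs) = Some (Suc v)))
      in if \<exists>n. P n then Some (THE n. P n) else None)"

inductive partial_recursive :: "nat \<Rightarrow> (nat list \<Rightarrow> nat option) \<Rightarrow> bool" where
  zero: "partial_recursive k (\<lambda>xs. Some 0)"
| succ: "partial_recursive 1 (\<lambda>xs. Some (Suc (hd xs)))"
| proj: "i < k \<Longrightarrow> partial_recursive k (\<lambda>xs. Some (xs ! i))"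
| comp: "partial_recursive (length gs) f \<Longrightarrow> (\<And>g. g \<in> set gs \<Longrightarrow> partial_recursive k g)
    \<Longrightarrow> partial_recursive k (pr_comp f gs)"
| prim_rec: "partial_recursive k f \<Longrightarrow> partial_recursive (Suc (Suc k)) g
    \<Longrightarrow> partial_recursive (Suc k) (pr_primrec f g)"
| min: "partial_recursive (Suc k) f \<Longrightarrow> partial_recursive k (pr_min f)"

definition computably_enumerable :: "nat \<Rightarrow> nat list set \<Rightarrow> bool" where
  "computably_enumerable k W \<longleftrightarrow>
     (\<exists>f. partial_recursive k f \<and> W = {xs. length xs = k \<and> f xs \<noteq> None})"

section \<open>Martin-Loef randomness\<close>

text \<open>
  The argument \<open>B\<close> is an effective enumeration of a base of the topology of the underlying space.
\<close>

definition uniformly_effectively_open :: "(nat \<Rightarrow> 'a set) \<Rightarrow> (nat \<Rightarrow> 'a set) \<Rightarrow> bool" where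
  "uniformly_effectively_open B U \<longleftrightarrow>
     (\<exists>W. computably_enumerable 2 W \<and> (\<forall>i. U i = (\<Union>n\<in>{n. [i, n] \<in> W}. B n)))"

definition martin_loef_test :: "'a measure \<Rightarrow> (nat \<Rightarrow> 'a set) \<Rightarrow> (nat \<Rightarrow> 'a set) \<Rightarrow> bool" where
  "martin_loef_test M B U \<longleftrightarrow>
     uniformly_effectively_open B U \<and> (\<forall>i. emeasure M (U i) \<le> ennreal ((1 / 2) ^ i))"

definition martin_loef_random :: "'a measure \<Rightarrow> (nat \<Rightarrow> 'a set) \<Rightarrow> 'a \<Rightarrow> bool" where
  "martin_loef_random M B x \<longleftrightarrow>
     x \<in> space M \<and> (\<forall>U. martin_loef_test M B U \<longrightarrow> x \<notin> (\<Inter>i. U i))"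

subsection \<open>Random reals in the unit interval\<close>

text \<open>
  \<^const>\<open>nat_to_rat_surj\<close> is the library's (effective) enumeration of the rationals as fractions
  of integers.
\<close>

definition rational_interval :: "nat \<Rightarrow> real set" where
  "rational_interval n =
     (case prod_decode n of (u, v) \<Rightarrow>
        {of_rat (nat_to_rat_surj u) <..< of_rat (nat_to_rat_surj v)} \<inter> {0..1})"

definition lebesgue_random :: "real \<Rightarrow> bool" where
  "lebesgue_random x \<longleftrightarrow>
     martin_loef_random (restrict_space lborel {0..1}) rational_interval x"

subsection \<open>Bernoulli random sequences\<close>

text \<open>Infinite base-\<open>b\<close> sequences are functions \<open>nat \<Rightarrow> nat\<close> with all values below \<open>b\<close>.\<close>

definition sequences :: "nat \<Rightarrow> (nat \<Rightarrow> nat) set" where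
  "sequences b = {s. \<forall>k. s k < b}"

definition cylinder :: "nat \<Rightarrow> nat list \<Rightarrow> (nat \<Rightarrow> nat) set" where
  "cylinder b \<sigma> = {s \<in> sequences b. \<forall>j<length \<sigma>. s j = \<sigma> ! j}"

definition bernoulli_measure :: "nat \<Rightarrow> (nat \<Rightarrow> real) \<Rightarrow> (nat \<Rightarrow> nat) measure" where
  "bernoulli_measure b p = (\<Pi>\<^sub>M k\<in>UNIV. point_measure {..<b} (\<lambda>i. ennreal (p i)))"

text \<open>
  Every natural number decodes to a list; a list that is not a base-\<open>b\<close> block has an empty
  cylinder in \<^term>\<open>sequences b\<close>.
\<close>

definition bernoulli_random :: "nat \<Rightarrow> (nat \<Rightarrow> real) \<Rightarrow> (nat \<Rightarrow> nat) \<Rightarrow> bool" where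
  "bernoulli_random b p s \<longleftrightarrow>
     martin_loef_random (bernoulli_measure b p) (\<lambda>n. cylinder b (list_decode n)) s"

lemma space_bernoulli_measure: "space (bernoulli_measure b p) = sequences b"
  by (auto simp: bernoulli_measure_def space_PiM space_point_measure sequences_def PiE_def Pi_def)

text \<open>
  The product measure is the Borel probability measure on \<open>b\<^sup>\<omega>\<close> that is given by the
  product formula on cylinders.
\<close>

lemma prob_space_point_measure:
  fixes b :: nat and p :: "nat \<Rightarrow> real"
  assumes "\<And>i. i < b \<Longrightarrow> 0 \<le> p i" and "(\<Sum>i<b. p i) = (1::real)"
  shows "prob_space (point_measure {..<b} (\<lambda>i. ennreal (p i)))"
proof
  have "(\<Sum>i<b. ennreal (p i)) = ennreal (\<Sum>i<b. p i)"
    by (rule sum_ennreal) (use assms in auto)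
  then show "emeasure (point_measure {..<b} (\<lambda>i. ennreal (p i)))
      (space (point_measure {..<b} (\<lambda>i. ennreal (p i)))) = 1"
    unfolding space_point_measure emeasure_point_measure_finite[OF finite_lessThan subset_refl]
    by (simp only: assms(2) ennreal_1)
qed

lemma prob_space_bernoulli_measure:
  assumes "\<And>i. i < b \<Longrightarrow> 0 \<le> p i" and "(\<Sum>i<b. p i) = (1::real)"
  shows "prob_space (bernoulli_measure b p)"
  unfolding bernoulli_measure_def
  by (intro prob_space_PiM prob_space_point_measure assms)

lemma emeasure_bernoulli_cylinder:
  assumes "\<And>i. i < b \<Longrightarrow> 0 \<le> p i" and "(\<Sum>i<b. p i) = (1::real)"
    and "set \<sigma> \<subseteq> {..<b}"
  shows "emeasure (bernoulli_measure b p) (cylinder b \<sigma>) = ennreal (\<Prod>j<length \<sigma>. p (\<sigma> ! j))"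
proof -
  let ?M = "\<lambda>_::nat. point_measure {..<b} (\<lambda>i. ennreal (p i))"
  interpret product_prob_space ?M UNIV
    by (intro product_prob_spaceI prob_space_point_measure assms)
  have in_b: "\<sigma> ! j < b" if "j < length \<sigma>" for j
    using assms(3) that nth_mem by blast
  have "cylinder b \<sigma> = {s \<in> space (bernoulli_measure b p). \<forall>j\<in>{..<length \<sigma>}. s j \<in> {\<sigma> ! j}}"
    by (auto simp: cylinder_def space_bernoulli_measure)
  also have "emeasure (bernoulli_measure b p) \<dots> = (\<Prod>j<length \<sigma>. emeasure (?M j) {\<sigma> ! j})"
    unfolding bernoulli_measure_def
    by (rule emeasure_PiM_Collect) (auto simp: sets_point_measure in_b)
  also have "\<dots> = (\<Prod>j<length \<sigma>. ennreal (p (\<sigma> ! j)))"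
    by (intro prod.cong) (auto simp: emeasure_point_measure_finite in_b)
  also have "\<dots> = ennreal (\<Prod>j<length \<sigma>. p (\<sigma> ! j))"
    by (rule prod_ennreal) (use assms(1) in_b in auto)
  finally show ?thesis .
qed

lemma sets_bernoulli_measure:
  "sets (bernoulli_measure b p) = sigma_sets (sequences b) (cylinder b ` lists {..<b})"
proof (rule antisym)
  let ?S = "sigma_sets (sequences b) (cylinder b ` lists {..<b})"
  interpret S: sigma_algebra "sequences b" ?S
    by (rule sigma_algebra_sigma_sets) (auto simp: cylinder_def)
  have single: "{s \<in> sequences b. s k = a} \<in> ?S" for k a
  proof -
    let ?L = "{\<sigma> \<in> lists {..<b}. length \<sigma> = Suc k \<and> \<sigma> ! k = a}"
    have fin: "finite ?L"
      by (rule finite_subset[OF _ finite_lists_length_eq[of "{..<b}" "Suc k"]]) (auto simp: lists_eq_set)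
    have "s \<in> (\<Union>\<sigma>\<in>?L. cylinder b \<sigma>)" if "s \<in> sequences b" "s k = a" for s
    proof (rule UN_I[of "map s [0..<Suc k]"])
      show "map s [0..<Suc k] \<in> ?L"
        using that by (auto simp: sequences_def nth_append simp del: upt_Suc)
      show "s \<in> cylinder b (map s [0..<Suc k])"
        using that by (auto simp: cylinder_def simp del: upt_Suc)
    qed
    then have "{s \<in> sequences b. s k = a} = (\<Union>\<sigma>\<in>?L. cylinder b \<sigma>)"
      by (auto simp: cylinder_def)
    also have "\<dots> \<in> ?S"
      by (rule S.finite_UN[OF fin]) (auto intro: sigma_sets.Basic)
    finally show ?thesis .
  qed
  show "sets (bernoulli_measure b p) \<subseteq> ?S"
  proof -
    let ?P = "\<Pi>\<^sub>E k\<in>UNIV. space (point_measure {..<b} (\<lambda>i. ennreal (p i)))"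
    have P: "?P = sequences b"
      by (auto simp: space_point_measure sequences_def PiE_def Pi_def)
    have "{s \<in> sequences b. s k \<in> A} \<in> ?S" if "A \<subseteq> {..<b}" for k A
    proof -
      have "{s \<in> sequences b. s k \<in> A} = (\<Union>a\<in>A. {s \<in> sequences b. s k = a})"
        by auto
      also have "\<dots> \<in> ?S"
        using finite_subset[OF that] by (intro S.finite_UN single) auto
      finally show ?thesis .
    qed
    then show ?thesis
      unfolding bernoulli_measure_def sets_PiM_single P
      by (intro S.sigma_sets_subset) (auto simp: sets_point_measure)
  qed
  show "?S \<subseteq> sets (bernoulli_measure b p)"
  proof -
    have "cylinder b \<sigma> \<in> sets (bernoulli_measure b p)" if "\<sigma> \<in> lists {..<b}" for \<sigma>
    proof -
      have "{s \<in> space (bernoulli_measure b p). \<forall>j\<in>{..<length \<sigma>}. s j \<in> {\<sigma> ! j} \<inter> {..<b}}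
          \<in> sets (bernoulli_measure b p)"
        unfolding bernoulli_measure_def
        by (intro sets.sets_Collect_finite_All sets_Collect_single')
          (auto simp: sets_point_measure space_point_measure)
      also have "{s \<in> space (bernoulli_measure b p). \<forall>j\<in>{..<length \<sigma>}. s j \<in> {\<sigma> ! j} \<inter> {..<b}}
          = cylinder b \<sigma>"
        by (auto simp: cylinder_def space_bernoulli_measure sequences_def)
      finally show ?thesis .
    qed
    then show ?thesis
      using sets.sigma_sets_subset[of "cylinder b ` lists {..<b}" "bernoulli_measure b p"]
      by (auto simp: space_bernoulli_measure)
  qed
qed

section \<open>Digit sequences\<close>

text \<open>For real \<open>x\<close> outside \<open>[0,1)\<close> these are the digits of the fractional part of \<open>x\<close>.\<close>

definition is_digit_sequence :: "nat \<Rightarrow> real \<Rightarrow> (nat \<Rightarrow> nat) \<Rightarrow> bool" where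
  "is_digit_sequence B x s \<longleftrightarrow>
     s \<in> sequences B \<and> infinite {k. s k \<noteq> B - 1} \<and>
     (\<lambda>k. real (s k) / real B ^ Suc k) sums frac x"

definition digit_sequence :: "nat \<Rightarrow> real \<Rightarrow> nat \<Rightarrow> nat" where
  "digit_sequence B x = (THE s. is_digit_sequence B x s)"

definition digit_tail :: "nat \<Rightarrow> (nat \<Rightarrow> nat) \<Rightarrow> nat \<Rightarrow> real" where
  "digit_tail B s n = (\<Sum>k. real (s (n + k)) / real B ^ Suc k)"

lemma digit_sequence_step:
  assumes "is_digit_sequence B x s" and "B \<ge> 2"
  shows "digit_tail B s 0 = frac x"
    and "s n = nat \<lfloor>real B * digit_tail B s n\<rfloor>"
    and "digit_tail B s (Suc n) = frac (real B * digit_tail B s n)"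
proof -
  define t where "t = digit_tail B s"
  have t_eq: "t = (\<lambda>n. \<Sum>k. real (s (n + k)) / real B ^ Suc k)"
    by (simp only: t_def digit_tail_def fun_eq_iff) simp
  have s: "s k < B" for k
    using assms(1) by (auto simp: is_digit_sequence_def sequences_def)
  have geo: "(\<lambda>k. real (B - 1) / real B ^ Suc k) sums 1"
  proof -
    have "(\<lambda>k. (real (B - 1) / real B) * (1 / real B) ^ k) sums
        ((real (B - 1) / real B) * (1 / (1 - 1 / real B)))"
      by (intro sums_mult geometric_sums) (use assms(2) in auto)
    moreover have "(real (B - 1) / real B) * (1 / (1 - 1 / real B)) = 1"
      using assms(2) by (simp add: field_simps of_nat_diff)
    moreover have "(\<lambda>k. (real (B - 1) / real B) * (1 / real B) ^ k) = (\<lambda>k. real (B - 1) / real B ^ Suc k)"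
      by (simp add: power_divide)
    ultimately show ?thesis
      by (simp only:)
  qed
  have le: "real (s k) / real B ^ Suc m \<le> real (B - 1) / real B ^ Suc m" for k m
    using s[of k] by (intro divide_right_mono) auto
  have summ: "summable (\<lambda>k. real (s (n + k)) / real B ^ Suc k)" for n
    by (rule summable_comparison_test'[OF sums_summable[OF geo], of 0]) (use le in auto)
  have nonneg: "0 \<le> t n" for n
    unfolding t_eq by (intro suminf_nonneg summ) auto
  have less1: "t n < 1" for n
  proof -
    obtain k where k: "k \<ge> n" "s k \<noteq> B - 1"
      using assms(1) unfolding is_digit_sequence_def infinite_nat_iff_unbounded_le by auto
    define f where "f = (\<lambda>j. real (B - 1) / real B ^ Suc j - real (s (n + j)) / real B ^ Suc j)"
    have f: "f sums (1 - t n)"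
      unfolding f_def t_eq by (intro sums_diff geo summable_sums summ)
    have "0 < f (k - n)"
      using k s[of k] assms(2) by (auto simp: f_def intro!: divide_strict_right_mono)
    then have "0 < suminf f"
      by (intro suminf_pos2[OF sums_summable[OF f], of "k - n"]) (use le in \<open>auto simp: f_def\<close>)
    then show ?thesis
      using sums_unique[OF f] by simp
  qed
  show "digit_tail B s 0 = frac x"
    using assms(1) unfolding t_def[symmetric] by (simp add: t_eq is_digit_sequence_def sums_iff)
  have "t n = real (s n) / real B + (\<Sum>k. real (s (n + Suc k)) / real B ^ Suc (Suc k))"
    unfolding t_eq using suminf_split_head[OF summ[of n]] by simp
  also have "(\<Sum>k. real (s (n + Suc k)) / real B ^ Suc (Suc k)) =
      (\<Sum>k. (real (s (Suc n + k)) / real B ^ Suc k) / real B)"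
    by (simp add: mult.commute)
  also have "\<dots> = t (Suc n) / real B"
    unfolding t_eq by (rule suminf_divide[OF summ])
  finally have eq: "real B * t n = real (s n) + t (Suc n)"
    using assms(2) by (simp add: field_simps)
  have fl: "\<lfloor>real B * t n\<rfloor> = int (s n)"
    unfolding eq using nonneg[of "Suc n"] less1[of "Suc n"] by linarith
  show "s n = nat \<lfloor>real B * digit_tail B s n\<rfloor>"
    unfolding t_def[symmetric] using fl by simp
  show "digit_tail B s (Suc n) = frac (real B * digit_tail B s n)"
    unfolding t_def[symmetric] frac_def fl using eq by simp
qed

lemma is_digit_sequence_unique:
  assumes "is_digit_sequence B x s" and "is_digit_sequence B x s'" and "B \<ge> 2"
  shows "s = s'"
proof
  fix n
  note step = digit_sequence_step[OF assms(1,3)] and step' = digit_sequence_step[OF assms(2,3)]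
  have "digit_tail B s n = digit_tail B s' n"
    by (induction n) (simp_all only: step(1,3) step'(1,3))
  then show "s n = s' n"
    using step(2)[of n] step'(2)[of n] by simp
qed

lemma is_digit_sequence_floor:
  assumes "B \<ge> 2"
  shows "is_digit_sequence B x (\<lambda>k. nat (\<lfloor>frac x * real B ^ Suc k\<rfloor> mod int B))"
proof -
  define y where "y = frac x"
  have y: "0 \<le> y" "y < 1"
    by (simp_all add: y_def frac_lt_1)
  define s where "s = (\<lambda>k. nat (\<lfloor>y * real B ^ Suc k\<rfloor> mod int B))"
  have B: "real B > 0" "real B \<noteq> 0"
    using assms by auto
  have div: "\<lfloor>y * real B ^ Suc k\<rfloor> div int B = \<lfloor>y * real B ^ k\<rfloor>" for k
  proof -
    have "\<lfloor>(y * real B ^ Suc k) / real_of_int (int B)\<rfloor> = \<lfloor>y * real B ^ Suc k\<rfloor> div int B"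
      by (rule floor_divide_real_eq_div) simp
    then show ?thesis
      using B by simp
  qed
  have rec: "real_of_int \<lfloor>y * real B ^ Suc k\<rfloor> = real B * real_of_int \<lfloor>y * real B ^ k\<rfloor> + real (s k)" for k
  proof -
    have "int (s k) = \<lfloor>y * real B ^ Suc k\<rfloor> mod int B"
      using assms by (simp add: s_def)
    then have "\<lfloor>y * real B ^ Suc k\<rfloor> = int B * \<lfloor>y * real B ^ k\<rfloor> + int (s k)"
      using mult_div_mod_eq[of "int B" "\<lfloor>y * real B ^ Suc k\<rfloor>"] unfolding div by linarith
    then show ?thesis
      by (metis of_int_add of_int_mult of_int_of_nat_eq)
  qed
  have partial: "(\<Sum>k<n. real (s k) / real B ^ Suc k) = real_of_int \<lfloor>y * real B ^ n\<rfloor> / real B ^ n" for n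
  proof (induction n)
    case 0
    then show ?case using y by (simp add: floor_eq_iff)
  next
    case (Suc n)
    then show ?case using rec[of n] B by (simp add: field_simps)
  qed
  have bound: "y - 1 / real B ^ n < (\<Sum>k<n. real (s k) / real B ^ Suc k)"
    and bound': "(\<Sum>k<n. real (s k) / real B ^ Suc k) \<le> y" for n
  proof -
    have "y * real B ^ n - 1 < real_of_int \<lfloor>y * real B ^ n\<rfloor>" "real_of_int \<lfloor>y * real B ^ n\<rfloor> \<le> y * real B ^ n"
      by linarith+
    then show "y - 1 / real B ^ n < (\<Sum>k<n. real (s k) / real B ^ Suc k)"
      "(\<Sum>k<n. real (s k) / real B ^ Suc k) \<le> y"
      unfolding partial using B by (simp_all add: pos_less_divide_eq pos_divide_le_eq left_diff_distrib)
  qed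
  have null: "(\<lambda>n. 1 / real B ^ n) \<longlonglongrightarrow> 0"
  proof -
    have "(\<lambda>n. (1 / real B) ^ n) \<longlonglongrightarrow> 0"
      by (rule LIMSEQ_realpow_zero) (use assms in auto)
    then show ?thesis by (simp add: power_divide)
  qed
  have sums: "(\<lambda>k. real (s k) / real B ^ Suc k) sums y"
    unfolding sums_def
  proof (rule tendsto_sandwich[OF always_eventually always_eventually])
    show "(\<lambda>n. y - 1 / real B ^ n) \<longlonglongrightarrow> y"
      using tendsto_diff[OF tendsto_const null, of y] by simp
    show "(\<lambda>n. y) \<longlonglongrightarrow> y"
      by simp
  qed (use bound bound' less_imp_le in blast)+
  have inf: "infinite {k. s k \<noteq> B - 1}"
  proof
    assume "finite {k. s k \<noteq> B - 1}"
    then obtain N where N: "\<And>k. k \<ge> N \<Longrightarrow> s k = B - 1"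
      unfolding finite_nat_set_iff_bounded by (auto simp: not_less[symmetric])
    have part: "(\<Sum>k<N + m. real (s k) / real B ^ Suc k) =
        (\<Sum>k<N. real (s k) / real B ^ Suc k) + 1 / real B ^ N - 1 / real B ^ (N + m)" for m
    proof (induction m)
      case (Suc m)
      have "real (s (N + m)) = real B - 1"
        using N[of "N + m"] assms by (simp add: of_nat_diff)
      then have "real (s (N + m)) / real B ^ Suc (N + m) = 1 / real B ^ (N + m) - 1 / real B ^ Suc (N + m)"
        using B by (simp add: field_simps)
      then show ?case
        using Suc by (simp del: power_Suc)
    qed simp
    have "(\<lambda>m. \<Sum>k<N + m. real (s k) / real B ^ Suc k) \<longlonglongrightarrow> y"
      using sums LIMSEQ_ignore_initial_segment[of _ y N] by (simp add: sums_def add.commute)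
    moreover have "(\<lambda>m. \<Sum>k<N + m. real (s k) / real B ^ Suc k) \<longlonglongrightarrow>
        (\<Sum>k<N. real (s k) / real B ^ Suc k) + 1 / real B ^ N - 0"
      unfolding part using LIMSEQ_ignore_initial_segment[OF null, of N]
      by (intro tendsto_diff tendsto_const) (simp add: add.commute)
    ultimately have "y = (\<Sum>k<N. real (s k) / real B ^ Suc k) + 1 / real B ^ N - 0"
      by (rule LIMSEQ_unique)
    then show False
      using bound[of N] by simp
  qed
  have "s k < B" for k
    using assms by (simp add: s_def nat_less_iff)
  then have "s \<in> sequences B"
    by (simp add: sequences_def)
  then have "is_digit_sequence B x s"
    unfolding is_digit_sequence_def y_def[symmetric] using sums inf by blast
  then show ?thesis
    by (simp only: s_def y_def)
qed

lemma is_digit_sequence_digit_sequence: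
  assumes "B \<ge> 2"
  shows "is_digit_sequence B x (digit_sequence B x)"
proof -
  have "\<exists>!s. is_digit_sequence B x s"
    using is_digit_sequence_floor[OF assms] is_digit_sequence_unique[OF _ _ assms] by blast
  then show ?thesis
    unfolding digit_sequence_def by (rule theI')
qed

end

theory Submission
  imports Defs
begin

text \<open>
  The recoding \<open>F y = (\<lambda>k. g ! (y)\<^sub>d[k])\<close> pushes Lebesgue measure forward to the Bernoulli measure:
  the number of base-\<open>d\<close> blocks that \<open>g\<close> sends to \<open>\<sigma>\<close> is \<open>\<Prod>\<^sub>j p\<^bsub>\<sigma>[j]\<^esub> d\<close>. A Bernoulli test that captures
  \<open>F x\<close> is therefore pulled back to a Lebesgue test that consists of the open intervals
  \<open>(K / d\<^sup>L, (K + 1) / d\<^sup>L)\<close> whose recoded block is enumerated. It captures \<open>x\<close> unless \<open>x\<close> is an end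
  point, and a random \<open>x\<close> is not, being irrational. A code of an interval determines \<open>K\<close> and \<open>L\<close>, so
  one unbounded search for them followed by the given semi-decision procedure enumerates the
  pulled-back test; no dovetailing is needed.
\<close>

section \<open>Total recursive functions\<close>

text \<open>Total functions on lists hide the options, so closure properties can be stated for
  ordinary arithmetic terms.\<close>

definition computable :: "nat \<Rightarrow> (nat list \<Rightarrow> nat) \<Rightarrow> bool" where
  "computable k h \<longleftrightarrow>
     (\<exists>F. partial_recursive k F \<and> (\<forall>xs. length xs = k \<longrightarrow> F xs = Some (h xs)))"

lemma computable_cong:
  assumes "computable k h" and "\<And>xs. length xs = k \<Longrightarrow> h xs = h' xs"
  shows "computable k h'"
  using assms unfolding computable_def by metis

lemma computable_proj:
  assumes "i < k"
  shows "computable k (\<lambda>xs. xs ! i)"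
  unfolding computable_def using partial_recursive.proj[OF assms] by blast

lemma computable_comp:
  assumes "computable (length hs) h" and "\<And>h'. h' \<in> set hs \<Longrightarrow> computable k h'"
  shows "computable k (\<lambda>xs. h (map (\<lambda>h'. h' xs) hs))"
proof -
  obtain H where H: "partial_recursive (length hs) H"
    and H': "\<And>xs. length xs = length hs \<Longrightarrow> H xs = Some (h xs)"
    using assms(1) unfolding computable_def by blast
  obtain F where F: "\<And>h'. h' \<in> set hs \<Longrightarrow> partial_recursive k (F h')"
    and F': "\<And>h' xs. h' \<in> set hs \<Longrightarrow> length xs = k \<Longrightarrow> F h' xs = Some (h' xs)"
    using assms(2) unfolding computable_def by metis
  have "partial_recursive k (pr_comp H (map F hs))"
    by (rule partial_recursive.comp) (use H F in auto)
  moreover have "pr_comp H (map F hs) xs = Some (h (map (\<lambda>h'. h' xs) hs))" if "length xs = k" for xs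
  proof -
    have "map (\<lambda>g. the (g xs)) (map F hs) = map (\<lambda>h'. h' xs) hs"
      using F' that by (simp add: comp_def)
    then show ?thesis
      using F' that by (auto simp: pr_comp_def H' intro!: arg_cong[of _ _ h])
  qed
  ultimately show ?thesis
    unfolding computable_def by blast
qed

lemma computable_comp1:
  assumes "computable 1 (\<lambda>xs. f (xs ! 0))" and "computable k u"
  shows "computable k (\<lambda>xs. f (u xs))"
  using computable_comp[of "[u]" "\<lambda>xs. f (xs ! 0)" k] assms by simp

text \<open>Reduces a binary operation on arbitrary computable arguments to the operation on two
  variables.\<close>

lemma computable_comp2:
  assumes "computable 2 (\<lambda>xs. f (xs ! 0) (xs ! 1))" and "computable k u" and "computable k v"
  shows "computable k (\<lambda>xs. f (u xs) (v xs))"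
  using computable_comp[of "[u, v]" "\<lambda>xs. f (xs ! 0) (xs ! 1)" k] assms
  by (auto simp: numeral_2_eq_2)

lemma computable_Suc:
  assumes "computable k u"
  shows "computable k (\<lambda>xs. Suc (u xs))"
proof -
  have "Some (Suc (hd xs)) = Some (Suc (xs ! 0))" if "length xs = 1" for xs :: "nat list"
    using that by (cases xs) auto
  then have "computable 1 (\<lambda>xs. Suc (xs ! 0))"
    unfolding computable_def using partial_recursive.succ by blast
  then show ?thesis
    by (rule computable_comp1[OF _ assms])
qed

lemma computable_const: "computable k (\<lambda>_. c)"
proof (induction c)
  case 0
  show ?case
    unfolding computable_def using partial_recursive.zero by blast
next
  case (Suc c)
  then show ?case
    by (rule computable_Suc)
qed

text \<open>\<open>pr_primrec\<close> recurses on the head of its list and passes on the tail.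
  Substituting \<open>n\<close> for the head and projections for the tail leaves \<open>xs\<close>
  itself as the parameters.\<close>

lemma computable_rec:
  assumes "computable k f" and "computable (Suc (Suc k)) g" and "computable k n"
  shows "computable k (\<lambda>xs. rec_nat (f xs) (\<lambda>m r. g (m # r # xs)) (n xs))"
proof -
  obtain F where F: "partial_recursive k F" and F': "\<And>xs. length xs = k \<Longrightarrow> F xs = Some (f xs)"
    using assms(1) unfolding computable_def by blast
  obtain G where G: "partial_recursive (Suc (Suc k)) G"
    and G': "\<And>xs. length xs = Suc (Suc k) \<Longrightarrow> G xs = Some (g xs)"
    using assms(2) unfolding computable_def by blast
  let ?h = "\<lambda>xs. rec_nat (f (tl xs)) (\<lambda>m r. g (m # r # tl xs)) (hd xs)"
  have "pr_primrec F G xs = Some (?h xs)" if "length xs = Suc k" for xs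
  proof -
    have "rec_nat (F (tl xs)) (\<lambda>m r. Option.bind r (\<lambda>v. G (m # v # tl xs))) n =
        Some (rec_nat (f (tl xs)) (\<lambda>m r. g (m # r # tl xs)) n)" for n
      by (induction n) (use that F' G' in auto)
    then show ?thesis
      by (simp add: pr_primrec_def)
  qed
  then have h: "computable (Suc k) ?h"
    unfolding computable_def using partial_recursive.prim_rec[OF F G] by blast
  let ?hs = "n # map (\<lambda>i xs. xs ! i) [0..<k]"
  have "computable k (\<lambda>xs. ?h (map (\<lambda>h'. h' xs) ?hs))"
    by (rule computable_comp) (use h assms(3) computable_proj in auto)
  then show ?thesis
  proof (rule computable_cong)
    fix xs :: "nat list"
    assume "length xs = k"
    then have "map (\<lambda>h'. h' xs) ?hs = n xs # xs"
      by (auto simp: comp_def map_nth)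
    then show "?h (map (\<lambda>h'. h' xs) ?hs) = rec_nat (f xs) (\<lambda>m r. g (m # r # xs)) (n xs)"
      by (simp only: list.sel)
  qed
qed

section \<open>Arithmetic operations\<close>

lemma computable_add:
  assumes "computable k u" and "computable k v"
  shows "computable k (\<lambda>xs. u xs + v xs)"
proof (rule computable_comp2[OF _ assms])
  \<comment> \<open>In \<open>m # r # xs\<close>, position 0 is the iteration counter, 1 the
    previous value, and the parameters start at 2.\<close>
  have "computable 2 (\<lambda>xs. rec_nat (xs ! 1) (\<lambda>m r. Suc ((m # r # xs) ! 1)) (xs ! 0))"
    by (intro computable_rec computable_Suc computable_proj) auto
  moreover have "rec_nat y (\<lambda>m r. Suc ((m # r # xs) ! 1)) x = x + y" for x y :: nat and xs
    by (induction x) auto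
  ultimately show "computable 2 (\<lambda>xs. xs ! 0 + xs ! 1)"
    by simp
qed

lemma computable_mult:
  assumes "computable k u" and "computable k v"
  shows "computable k (\<lambda>xs. u xs * v xs)"
proof (rule computable_comp2[OF _ assms])
  have "computable 2 (\<lambda>xs. rec_nat 0 (\<lambda>m r. (m # r # xs) ! 1 + (m # r # xs) ! 3) (xs ! 0))"
    by (intro computable_rec computable_add computable_proj computable_const) auto
  moreover have "rec_nat 0 (\<lambda>m r. (m # r # xs) ! 1 + (m # r # xs) ! 3) x = x * (xs ! 1)" for x :: nat and xs
    by (induction x) (auto simp: numeral_3_eq_3)
  ultimately show "computable 2 (\<lambda>xs. xs ! 0 * xs ! 1)"
    by simp
qed

lemma computable_power:
  assumes "computable k u" and "computable k v"
  shows "computable k (\<lambda>xs. u xs ^ v xs)"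
proof (rule computable_comp2[OF _ assms])
  have "computable 2 (\<lambda>xs. rec_nat 1 (\<lambda>m r. (m # r # xs) ! 1 * (m # r # xs) ! 2) (xs ! 1))"
    by (intro computable_rec computable_mult computable_proj computable_const) auto
  moreover have "rec_nat 1 (\<lambda>m r. (m # r # xs) ! 1 * (m # r # xs) ! 2) x = (xs ! 0) ^ x" for x :: nat and xs
    by (induction x) auto
  ultimately show "computable 2 (\<lambda>xs. xs ! 0 ^ xs ! 1)"
    by simp
qed

lemma computable_diff:
  assumes "computable k u" and "computable k v"
  shows "computable k (\<lambda>xs. u xs - v xs)"
proof (rule computable_comp2[OF _ assms])
  \<comment> \<open>The predecessor is the recursion that returns its counter; truncated subtraction
    iterates it.\<close>
  have "computable 1 (\<lambda>xs. rec_nat 0 (\<lambda>m r. (m # r # xs) ! 0) (xs ! 0))"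
    by (intro computable_rec computable_proj computable_const) auto
  moreover have "rec_nat 0 (\<lambda>m r. (m # r # xs) ! 0) x = x - 1" for x :: nat and xs
    by (cases x) auto
  ultimately have pred: "computable 1 (\<lambda>xs. xs ! 0 - 1)"
    by simp
  have "computable 2 (\<lambda>xs. rec_nat (xs ! 0) (\<lambda>m r. (m # r # xs) ! 1 - 1) (xs ! 1))"
    by (intro computable_rec computable_comp1[OF pred] computable_proj) auto
  moreover have "rec_nat y (\<lambda>m r. (m # r # xs) ! 1 - 1) x = y - x" for x y :: nat and xs
    by (induction x) auto
  ultimately show "computable 2 (\<lambda>xs. xs ! 0 - xs ! 1)"
    by simp
qed

lemma computable_if_eq:
  assumes "computable k a" and "computable k b" and "computable k u" and "computable k v"
  shows "computable k (\<lambda>xs. if a xs = b xs then u xs else v xs)"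
proof -
  \<comment> \<open>The indicator of equality: for distinct values one of the truncated differences
    is positive.\<close>
  let ?e = "\<lambda>xs. 1 - ((a xs - b xs) + (b xs - a xs))"
  have "computable k (\<lambda>xs. ?e xs * u xs + (1 - ?e xs) * v xs)"
    by (intro computable_add computable_mult computable_diff computable_const assms)
  moreover have "?e xs * u xs + (1 - ?e xs) * v xs = (if a xs = b xs then u xs else v xs)" for xs
    by auto
  ultimately show ?thesis
    by simp
qed

lemma computable_mod:
  assumes "computable k u" and "computable k v"
  shows "computable k (\<lambda>xs. u xs mod v xs)"
proof (rule computable_comp2[OF _ assms])
  \<comment> \<open>The running remainder is reset when its successor reaches the divisor. For
    divisor 0 this never happens, in accordance with \<open>x mod 0 = x\<close>.\<close>
  have "computable 2 (\<lambda>xs. rec_nat 0 (\<lambda>m r.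
      if Suc ((m # r # xs) ! 1) = (m # r # xs) ! 3 then 0 else Suc ((m # r # xs) ! 1)) (xs ! 0))"
    by (intro computable_rec computable_if_eq computable_Suc computable_proj computable_const) auto
  moreover have "rec_nat 0 (\<lambda>m r.
      if Suc ((m # r # xs) ! 1) = (m # r # xs) ! 3 then 0 else Suc ((m # r # xs) ! 1)) x = x mod (xs ! 1)"
    for x :: nat and xs
    by (induction x) (auto simp: mod_Suc numeral_3_eq_3)
  ultimately show "computable 2 (\<lambda>xs. xs ! 0 mod xs ! 1)"
    by simp
qed

lemma computable_div:
  assumes "computable k u" and "computable k v"
  shows "computable k (\<lambda>xs. u xs div v xs)"
proof (rule computable_comp2[OF _ assms])
  \<comment> \<open>The quotient grows exactly at the multiples of the divisor; for divisor 0 it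
    stays 0, as \<open>x div 0\<close> does.\<close>
  have "computable 2 (\<lambda>xs. rec_nat 0 (\<lambda>m r.
      if Suc ((m # r # xs) ! 0) mod (m # r # xs) ! 3 = 0
      then Suc ((m # r # xs) ! 1) else (m # r # xs) ! 1) (xs ! 0))"
    by (intro computable_rec computable_if_eq computable_mod computable_Suc computable_proj computable_const) auto
  moreover have "rec_nat 0 (\<lambda>m r. if Suc ((m # r # xs) ! 0) mod (m # r # xs) ! 3 = 0
      then Suc ((m # r # xs) ! 1) else (m # r # xs) ! 1) x = x div (xs ! 1)"
    for x :: nat and xs
    by (induction x) (auto simp: div_Suc numeral_3_eq_3)
  ultimately show "computable 2 (\<lambda>xs. xs ! 0 div xs ! 1)"
    by simp
qed

lemma computable_prod_encode:
  assumes "computable k u" and "computable k v"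
  shows "computable k (\<lambda>xs. prod_encode (u xs, v xs))"
  unfolding prod_encode_def triangle_def prod.case
  by (intro computable_add computable_mult computable_div computable_Suc computable_const assms)

text \<open>Finitely many values of an arbitrary \<open>f\<close> can be hard-wired, with one
  equality test each. The digit map enters the computation in this way.\<close>

lemma computable_finite_table:
  assumes "computable k u"
  shows "computable k (\<lambda>xs. if u xs < n then f (u xs) else 0)"
proof (induction n)
  case 0
  show ?case
    using computable_const[of k 0] by simp
next
  case (Suc n)
  have "computable k (\<lambda>xs. if u xs = n then f n else if u xs < n then f (u xs) else 0)"
    by (intro computable_if_eq Suc assms computable_const)
  then show ?case
    by (rule computable_cong) auto
qed

section \<open>Computably enumerable sets of pairs\<close>

text \<open>The composition of \<open>f\<close>, \<open>h\<close> and a minimization is defined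
  exactly when the search halts and \<open>f\<close> then halts on the value computed from its
  result.\<close>

lemma computably_enumerable_search:
  assumes "computably_enumerable 2 W" and "computable 3 t" and "computable 3 h"
  shows "computably_enumerable 2
    {[i, m] | i m. \<exists>z. t [z, i, m] = 0 \<and> (\<forall>y<z. t [y, i, m] \<noteq> 0) \<and> [i, h [z, i, m]] \<in> W}"
proof -
  obtain f where f: "partial_recursive 2 f" and W: "W = {xs. length xs = 2 \<and> f xs \<noteq> None}"
    using assms(1) unfolding computably_enumerable_def by blast
  obtain T where T: "partial_recursive (Suc 2) T" and T': "\<And>xs. length xs = 3 \<Longrightarrow> T xs = Some (t xs)"
    using assms(2) unfolding computable_def by auto
  obtain H where H: "partial_recursive 3 H" and H': "\<And>xs. length xs = 3 \<Longrightarrow> H xs = Some (h xs)"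
    using assms(3) unfolding computable_def by auto
  let ?H = "pr_comp H [pr_min T, \<lambda>xs. Some (xs ! 0), \<lambda>xs. Some (xs ! 1)]"
  let ?F = "pr_comp f [\<lambda>xs. Some (xs ! 0), ?H]"
  have "partial_recursive 2 ?H"
    by (rule partial_recursive.comp)
      (use H partial_recursive.min[OF T] partial_recursive.proj in \<open>auto simp: numeral_3_eq_3\<close>)
  then have F: "partial_recursive 2 ?F"
    using f partial_recursive.proj by (intro partial_recursive.comp) (auto simp: numeral_2_eq_2)
  have dom: "?F [i, m] \<noteq> None \<longleftrightarrow>
      (\<exists>z. t [z, i, m] = 0 \<and> (\<forall>y<z. t [y, i, m] \<noteq> 0) \<and> f [i, h [z, i, m]] \<noteq> None)" for i m
  proof -
    let ?P = "\<lambda>z. t [z, i, m] = 0 \<and> (\<forall>y<z. t [y, i, m] \<noteq> 0)"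
    have uniq: "y = z" if "?P y" "?P z" for y z
      using that by (meson linorder_neqE_nat)
    \<comment> \<open>\<open>T\<close> is total on lists of length 3, so the definedness condition
      in \<open>pr_min\<close> only says that the earlier values are nonzero.\<close>
    have "(\<exists>v. t [y, i, m] = Suc v) \<longleftrightarrow> t [y, i, m] \<noteq> 0" for y
      by (cases "t [y, i, m]") auto
    then have min: "pr_min T [i, m] = (if \<exists>z. ?P z then Some (THE z. ?P z) else None)"
      by (simp add: pr_min_def Let_def T')
    show ?thesis
    proof (cases "\<exists>z. ?P z")
      case True
      then obtain z where z: "?P z" by blast
      then have "(THE z. ?P z) = z"
        using uniq by (intro the_equality) blast+
      with min True have "pr_min T [i, m] = Some z" by simp
      then have "?F [i, m] = f [i, h [z, i, m]]"
        by (simp add: pr_comp_def H')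
      with z show ?thesis
        using uniq[OF _ z] by (metis (no_types, lifting))
    next
      case False
      with min have "pr_min T [i, m] = None" by simp
      then have "?F [i, m] = None"
        by (simp add: pr_comp_def)
      with False show ?thesis by blast
    qed
  qed
  have W': "[i, v] \<in> W \<longleftrightarrow> f [i, v] \<noteq> None" for i v
    by (simp add: W)
  have pair: "length xs = 2 \<longleftrightarrow> (\<exists>i m. xs = [i, m])" for xs :: "nat list"
    by (auto simp: length_Suc_conv numeral_2_eq_2)
  show ?thesis
    unfolding computably_enumerable_def
    by (intro exI[of _ ?F] conjI F) (unfold W' dom[symmetric] pair, blast)
qed

text \<open>Replaces the codes \<open>e L K\<close> by the codes \<open>c L K\<close>. Injectivity
  of \<open>c\<close> leaves only one pair to query, so halting at the first hit misses
  nothing.\<close>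

lemma computably_enumerable_image:
  assumes "computably_enumerable 2 W"
    and c: "computable 2 (\<lambda>xs. c (xs ! 0) (xs ! 1))" and e: "computable 2 (\<lambda>xs. e (xs ! 0) (xs ! 1))"
    and inj: "\<And>L K L' K'. c L K = c L' K' \<Longrightarrow> L = L' \<and> K = K'"
    and le: "\<And>L K. L \<le> c L K"
  shows "computably_enumerable 2 {[i, c L K] | i L K. [i, e L K] \<in> W}"
proof -
  (* Since L \<le> c L K, a pair L, K with code m is found as the remainder and quotient of a single
     number by m + 1, which makes one unbounded search enough. *)
  let ?L = "\<lambda>xs. xs ! 0 mod Suc (xs ! 2)" and ?K = "\<lambda>xs. xs ! 0 div Suc (xs ! 2)"
  let ?t = "\<lambda>xs. (c (?L xs) (?K xs) - xs ! 2) + (xs ! 2 - c (?L xs) (?K xs))"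
  let ?h = "\<lambda>xs. e (?L xs) (?K xs)"
  have "computable 3 ?t" "computable 3 ?h"
    by (intro computable_add computable_diff computable_comp2[OF c] computable_comp2[OF e]
        computable_mod computable_div computable_Suc computable_proj; simp)+
  note ce = computably_enumerable_search[OF assms(1) this]
  have "(\<exists>z. ?t [z, i, m] = 0 \<and> (\<forall>y<z. ?t [y, i, m] \<noteq> 0) \<and> [i, ?h [z, i, m]] \<in> W) \<longleftrightarrow>
      (\<exists>L K. m = c L K \<and> [i, e L K] \<in> W)" (is "?lhs \<longleftrightarrow> ?rhs") for i m
  proof
    assume ?lhs
    then show ?rhs by fastforce
  next
    assume ?rhs
    then obtain L K where LK: "m = c L K" "[i, e L K] \<in> W" by blast
    let ?z = "L + K * Suc m"
    have "L < Suc m"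
      using le[of L K] LK(1) by simp
    then have z: "?z mod Suc m = L" "?z div Suc m = K"
      by (simp_all only: mod_mult_self1 div_mult_self1[OF nat.distinct(2)] div_less mod_less add_0_right)
    \<comment> \<open>By injectivity every zero of \<open>?t\<close> equals \<open>?z\<close>, so
      \<open>?z\<close> is automatically the least one.\<close>
    have least: "y = ?z" if "?t [y, i, m] = 0" for y
    proof -
      from that have "c (y mod Suc m) (y div Suc m) = m"
        by simp
      with LK(1) have "y mod Suc m = L" "y div Suc m = K"
        using inj by blast+
      then show ?thesis
        using mod_mult_div_eq[of y "Suc m"] by (simp add: mult.commute)
    qed
    have t: "?t [?z, i, m] = 0" and W: "[i, ?h [?z, i, m]] \<in> W"
      using z LK(2) LK(1)[symmetric] by (simp_all only: nth_Cons_0 numeral_2_eq_2 nth_Cons_Suc)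
    have "\<forall>y<?z. ?t [y, i, m] \<noteq> 0"
    proof (intro allI impI notI)
      fix y
      assume "y < ?z" and "?t [y, i, m] = 0"
      from this(1) show False
        unfolding least[OF \<open>?t [y, i, m] = 0\<close>] by simp
    qed
    with t W show ?lhs by blast
  qed
  then have "{[i, m] | i m. \<exists>z. ?t [z, i, m] = 0 \<and> (\<forall>y<z. ?t [y, i, m] \<noteq> 0) \<and> [i, ?h [z, i, m]] \<in> W} =
      {[i, c L K] | i L K. [i, e L K] \<in> W}"
    by (simp only:) blast
  with ce show ?thesis
    by (simp only:)
qed

text \<open>Serves tests whose levels are single basic sets.\<close>

lemma computably_enumerable_graph:
  assumes h: "computable 1 (\<lambda>xs. h (xs ! 0))"
  shows "computably_enumerable 2 {[i, h i] | i. True}"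
proof -
  \<comment> \<open>\<open>?t\<close> ignores the search variable: the search stops at 0 if
    \<open>m\<close> is the value at \<open>i\<close> and otherwise runs forever. The set queried
    afterwards consists of all pairs.\<close>
  let ?t = "\<lambda>xs. (h (xs ! 1) - xs ! 2) + (xs ! 2 - h (xs ! 1))"
  have "computably_enumerable 2 {xs. length xs = 2}"
    unfolding computably_enumerable_def using partial_recursive.zero[of 2] by fastforce
  moreover have "computable 3 ?t"
    by (intro computable_add computable_diff computable_comp1[OF h] computable_proj) auto
  ultimately have "computably_enumerable 2 {[i, m] | i m. \<exists>z. ?t [z, i, m] = 0 \<and>
      (\<forall>y<z. ?t [y, i, m] \<noteq> 0) \<and> [i, (\<lambda>_. 0) [z, i, m]] \<in> {xs. length xs = 2}}"
    by (intro computably_enumerable_search computable_const)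
  also have "{[i, m] | i m. \<exists>z. ?t [z, i, m] = 0 \<and> (\<forall>y<z. ?t [y, i, m] \<noteq> 0) \<and>
      [i, (\<lambda>_. 0) [z, i, m]] \<in> {xs. length xs = 2}} = {[i, h i] | i. True}"
    by auto
  finally show ?thesis .
qed

section \<open>Recoding digit sequences\<close>

text \<open>Uniqueness identifies the digit sequence with the one obtained by rounding.\<close>

lemma digit_sequence_floor:
  assumes "B \<ge> 2"
  shows "digit_sequence B x k = nat (\<lfloor>frac x * real B ^ Suc k\<rfloor> mod int B)"
  using is_digit_sequence_unique[OF is_digit_sequence_digit_sequence[OF assms]
      is_digit_sequence_floor[OF assms] assms]
  by (rule fun_cong)

section \<open>Blocks of digits\<close>

lemma map_upt_length_eq_iff: "map f [0..<length xs] = xs \<longleftrightarrow> (\<forall>j<length xs. f j = xs ! j)"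
  by (subst list_eq_iff_nth_eq) simp

text \<open>The last \<open>L\<close> base-\<open>d\<close> digits of \<open>K\<close>, most
  significant first and padded with zeros, with \<open>G\<close> applied to each.\<close>

primrec digit_block :: "nat \<Rightarrow> (nat \<Rightarrow> nat) \<Rightarrow> nat \<Rightarrow> nat \<Rightarrow> nat list" where
  "digit_block d G 0 K = []"
| "digit_block d G (Suc L) K = digit_block d G L (K div d) @ [G (K mod d)]"

lemma length_digit_block [simp]: "length (digit_block d G L K) = L"
  by (induction L arbitrary: K) auto

text \<open>The definition splits off the least significant digit at the end, while
  \<open>list_encode\<close> recurses from the front. Higher digits of \<open>K\<close> are ignored,
  so the same \<open>K\<close> serves for the tail.\<close>

lemma digit_block_Suc_Cons:
  "digit_block d G (Suc L) K = G (K div d ^ L mod d) # digit_block d G L K"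
proof (induction L arbitrary: K)
  case (Suc L)
  have "digit_block d G (Suc (Suc L)) K = digit_block d G (Suc L) (K div d) @ [G (K mod d)]"
    by (rule digit_block.simps)
  also have "digit_block d G (Suc L) (K div d) = G (K div d div d ^ L mod d) # digit_block d G L (K div d)"
    by (rule Suc)
  finally show ?case
    by (simp add: div_mult2_eq)
qed simp

lemma list_encode_digit_block:
  "list_encode (digit_block d G L K) =
     rec_nat 0 (\<lambda>j r. Suc (prod_encode (G (K div d ^ j mod d), r))) L"
  by (induction L) (simp_all add: digit_block_Suc_Cons del: digit_block.simps(2))

text \<open>The integer part of \<open>y * d ^ L\<close> carries the first \<open>L\<close> digits
  of \<open>y\<close>: dividing by \<open>d\<close> and rounding down undoes the last shift.\<close>

lemma digit_block_floor:
  assumes "d \<ge> 2" and "0 \<le> y" and "y < 1"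
  shows "digit_block d G L (nat \<lfloor>y * real d ^ L\<rfloor>) = map (\<lambda>j. G (digit_sequence d y j)) [0..<L]"
proof (induction L)
  case (Suc L)
  have "frac y = y"
    using assms by (simp add: frac_eq)
  then have last: "nat \<lfloor>y * real d ^ Suc L\<rfloor> mod d = digit_sequence d y L"
    using assms by (simp add: digit_sequence_floor nat_mod_distrib)
  have "\<lfloor>(y * real d ^ Suc L) / real_of_int (int d)\<rfloor> = \<lfloor>y * real d ^ Suc L\<rfloor> div int d"
    by (rule floor_divide_real_eq_div) simp
  moreover have "(y * real d ^ Suc L) / real_of_int (int d) = y * real d ^ L"
    using assms by simp
  ultimately have "nat \<lfloor>y * real d ^ Suc L\<rfloor> div d = nat \<lfloor>y * real d ^ L\<rfloor>"
    using assms by (simp only: nat_div_distrib nat_int zero_le_floor zero_le_mult_iff)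
      (simp add: nat_div_distrib)
  with last Suc show ?case by simp
qed simp

section \<open>Measuring and counting digit blocks\<close>

lemma emeasure_floor_vimage:
  assumes "D > 0" and "S \<subseteq> {..<D}"
  shows "{y \<in> {0..<1}. nat \<lfloor>y * real D\<rfloor> \<in> S} \<in> sets lborel"
    and "emeasure lborel {y \<in> {0..<1}. nat \<lfloor>y * real D\<rfloor> \<in> S} = ennreal (real (card S) / real D)"
proof -
  have fin: "finite S"
    using assms(2) finite_subset by blast
  \<comment> \<open>The points with integer part \<open>K\<close> form an interval of length
    \<open>1 / D\<close>. These are disjoint for distinct \<open>K\<close>, and \<open>K < D\<close>
    keeps them below 1.\<close>
  let ?I = "\<lambda>K::nat. {real K / real D ..< real (Suc K) / real D}"
  have floor: "0 \<le> y \<and> nat \<lfloor>y * real D\<rfloor> = K \<longleftrightarrow> y \<in> ?I K" for y K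
  proof
    assume "0 \<le> y \<and> nat \<lfloor>y * real D\<rfloor> = K"
    then have "real K \<le> y * real D \<and> y * real D < real (Suc K)"
      using assms(1) by (auto simp: nat_eq_iff) linarith+
    then show "y \<in> ?I K"
      using assms(1) by (simp add: pos_divide_le_eq pos_less_divide_eq)
  next
    assume y: "y \<in> ?I K"
    then have "real K \<le> y * real D" "y * real D < real (Suc K)"
      using assms(1) by (simp_all add: pos_divide_le_eq pos_less_divide_eq)
    then have "\<lfloor>y * real D\<rfloor> = int K"
      by (simp add: floor_eq_iff)
    moreover have "0 \<le> y"
      using y by (auto intro: order_trans[of 0 "real K / real D"])
    ultimately show "0 \<le> y \<and> nat \<lfloor>y * real D\<rfloor> = K"
      by simp
  qed
  have less1: "y < 1" if "K \<in> S" "y \<in> ?I K" for y K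
  proof -
    have "real (Suc K) / real D \<le> 1"
      using that(1) assms by (auto simp: divide_le_eq)
    with that(2) show ?thesis by auto
  qed
  have eq: "{y \<in> {0..<1}. nat \<lfloor>y * real D\<rfloor> \<in> S} = (\<Union>K\<in>S. ?I K)"
  proof (intro set_eqI iffI)
    fix y
    assume "y \<in> {y \<in> {0..<1}. nat \<lfloor>y * real D\<rfloor> \<in> S}"
    then have "0 \<le> y" "nat \<lfloor>y * real D\<rfloor> \<in> S" by simp_all
    then show "y \<in> (\<Union>K\<in>S. ?I K)"
      using floor by blast
  next
    fix y
    assume "y \<in> (\<Union>K\<in>S. ?I K)"
    then obtain K where K: "K \<in> S" "y \<in> ?I K" by blast
    then have "0 \<le> y" "nat \<lfloor>y * real D\<rfloor> = K" "y < 1"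
      using floor less1 by blast+
    with K(1) show "y \<in> {y \<in> {0..<1}. nat \<lfloor>y * real D\<rfloor> \<in> S}" by simp
  qed
  show "{y \<in> {0..<1}. nat \<lfloor>y * real D\<rfloor> \<in> S} \<in> sets lborel"
    unfolding eq using fin by (intro sets.finite_UN) auto
  have "m = n" if "y \<in> ?I m" "y \<in> ?I n" for y m n
    using floor[THEN iffD2, OF that(1)] floor[THEN iffD2, OF that(2)] by linarith
  then have "disjoint_family_on ?I S"
    unfolding disjoint_family_on_def by blast
  then have "emeasure lborel (\<Union>K\<in>S. ?I K) = (\<Sum>K\<in>S. emeasure lborel (?I K))"
    using fin by (intro sum_emeasure[symmetric]) auto
  also have "\<dots> = (\<Sum>K\<in>S. ennreal (1 / real D))"
  proof (rule sum.cong)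
    fix K assume "K \<in> S"
    have "real K / real D \<le> real (Suc K) / real D"
      by (simp add: divide_right_mono)
    moreover have "real (Suc K) / real D - real K / real D = 1 / real D"
      by (simp add: diff_divide_distrib[symmetric])
    ultimately show "emeasure lborel (?I K) = ennreal (1 / real D)"
      by simp
  qed simp
  also have "\<dots> = ennreal (real (card S) / real D)"
    by (subst sum_ennreal) auto
  finally show "emeasure lborel {y \<in> {0..<1}. nat \<lfloor>y * real D\<rfloor> \<in> S} = ennreal (real (card S) / real D)"
    unfolding eq .
qed

text \<open>Quotient and remainder by \<open>d\<close> split \<open>K\<close> just as the last entry
  splits off \<open>\<sigma>\<close>, so each entry contributes an independent factor.\<close>

lemma card_digit_block_eq:
  assumes "d > 0"
  shows "card {K. K < d ^ length \<sigma> \<and> digit_block d G (length \<sigma>) K = \<sigma>} =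
    (\<Prod>j<length \<sigma>. card {r. r < d \<and> G r = \<sigma> ! j})"
proof (induction \<sigma> rule: rev_induct)
  case Nil
  have "{K::nat. K < d ^ length [] \<and> digit_block d G (length []) K = []} = {0}"
    by auto
  then show ?case by simp
next
  case (snoc c \<sigma>)
  let ?A = "{K. K < d ^ length \<sigma> \<and> digit_block d G (length \<sigma>) K = \<sigma>}"
  let ?C = "{r. r < d \<and> G r = c}"
  let ?B = "{K. K < d ^ length (\<sigma> @ [c]) \<and> digit_block d G (length (\<sigma> @ [c])) K = \<sigma> @ [c]}"
  have "bij_betw (\<lambda>K. (K div d, K mod d)) ?B (?A \<times> ?C)"
  proof (rule bij_betw_byWitness[where f' = "\<lambda>(q, r). q * d + r"])
    show "(\<lambda>K. (K div d, K mod d)) ` ?B \<subseteq> ?A \<times> ?C"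
      using assms by (auto simp: less_mult_imp_div_less mult.commute)
    show "(\<lambda>(q, r). q * d + r) ` (?A \<times> ?C) \<subseteq> ?B"
    proof clarsimp
      fix q r
      assume "q < d ^ length \<sigma>" "r < d"
      then have "q * d + r < Suc q * d" "Suc q * d \<le> d ^ length \<sigma> * d"
        by (simp, intro mult_le_mono1, simp)
      then show "q * d + r < d * d ^ length \<sigma>"
        by (simp only: mult.commute[of d])
    qed
  qed auto
  then have "card ?B = card ?A * card ?C"
    by (simp only: bij_betw_same_card card_cartesian_product)
  also have "card ?A = (\<Prod>j<length \<sigma>. card {r. r < d \<and> G r = (\<sigma> @ [c]) ! j})"
    unfolding snoc by (intro prod.cong) (auto simp: nth_append)
  finally show ?case by (simp del: digit_block.simps)
qed

section \<open>The pushforward of Lebesgue measure under a digitwise recoding\<close>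

locale digit_recoding =
  fixes d b :: nat and G :: "nat \<Rightarrow> nat" and p :: "nat \<Rightarrow> real"
  assumes base: "2 \<le> d"
    and G_less: "\<And>r. r < d \<Longrightarrow> G r < b"
    and p_eq: "\<And>i. i < b \<Longrightarrow> p i = real (card {r. r < d \<and> G r = i}) / real d"
    and sum_p: "(\<Sum>i<b. p i) = 1"
begin

definition recode :: "real \<Rightarrow> nat \<Rightarrow> nat" where
  "recode y k = G (digit_sequence d y k)"

lemma recode_in_sequences: "recode y \<in> sequences b"
proof -
  have "digit_sequence d y k < d" for k
    using is_digit_sequence_digit_sequence[OF base, of y]
    unfolding is_digit_sequence_def sequences_def by blast
  then show ?thesis
    unfolding sequences_def recode_def using G_less by blast
qed

lemma recode_in_cylinder_iff:
  assumes "0 \<le> y" and "y < 1"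
  shows "recode y \<in> cylinder b \<sigma> \<longleftrightarrow>
    digit_block d G (length \<sigma>) (nat \<lfloor>y * real d ^ length \<sigma>\<rfloor>) = \<sigma>"
proof -
  have "recode y \<in> cylinder b \<sigma> \<longleftrightarrow> (\<forall>j<length \<sigma>. recode y j = \<sigma> ! j)"
    unfolding cylinder_def using recode_in_sequences by blast
  also have "\<dots> \<longleftrightarrow> map (\<lambda>j. G (digit_sequence d y j)) [0..<length \<sigma>] = \<sigma>"
    unfolding recode_def by (rule map_upt_length_eq_iff[symmetric])
  finally show ?thesis
    by (simp only: digit_block_floor[OF base assms])
qed

text \<open>Membership depends only on the integer part of \<open>y * d ^ length \<sigma>\<close>,
  so the measure is a count of blocks. The factors are counts because \<open>p_eq\<close> speaks
  only of digits below \<open>b\<close>, while \<open>\<sigma>\<close> is arbitrary.\<close>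

lemma recode_vimage_cylinder:
  shows "{y \<in> {0..<1}. recode y \<in> cylinder b \<sigma>} \<in> sets lborel"
    and "emeasure lborel {y \<in> {0..<1}. recode y \<in> cylinder b \<sigma>} =
      ennreal (\<Prod>j<length \<sigma>. real (card {r. r < d \<and> G r = \<sigma> ! j}) / real d)"
proof -
  let ?D = "d ^ length \<sigma>"
  let ?S = "{K. K < ?D \<and> digit_block d G (length \<sigma>) K = \<sigma>}"
  have D: "?D > 0"
    using base by simp
  have lt: "nat \<lfloor>y * real d ^ length \<sigma>\<rfloor> < ?D" if "0 \<le> y" "y < 1" for y
  proof -
    have "y * real d ^ length \<sigma> < real d ^ length \<sigma>"
      using that base by simp
    then have "y * real d ^ length \<sigma> < real ?D"
      by simp
    then show ?thesis
      using that by (simp add: nat_less_iff floor_less_iff)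
  qed
  have eq: "{y \<in> {0..<1}. recode y \<in> cylinder b \<sigma>} = {y \<in> {0..<1}. nat \<lfloor>y * real ?D\<rfloor> \<in> ?S}"
    using lt by (auto simp: recode_in_cylinder_iff)
  show "{y \<in> {0..<1}. recode y \<in> cylinder b \<sigma>} \<in> sets lborel"
    unfolding eq using D by (intro emeasure_floor_vimage) auto
  have "emeasure lborel {y \<in> {0..<1}. recode y \<in> cylinder b \<sigma>} = ennreal (real (card ?S) / real ?D)"
    unfolding eq using D by (intro emeasure_floor_vimage) auto
  also have "real (card ?S) / real ?D = (\<Prod>j<length \<sigma>. real (card {r. r < d \<and> G r = \<sigma> ! j}) / real d)"
    using base by (subst card_digit_block_eq) (simp_all add: prod_dividef)
  finally show "emeasure lborel {y \<in> {0..<1}. recode y \<in> cylinder b \<sigma>} =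
      ennreal (\<Prod>j<length \<sigma>. real (card {r. r < d \<and> G r = \<sigma> ! j}) / real d)" .
qed

lemma measurable_recode:
  "recode \<in> measurable (restrict_space lborel {0..<1}) (bernoulli_measure b p)"
proof (rule measurable_sigma_sets[OF sets_bernoulli_measure])
  show "cylinder b ` lists {..<b} \<subseteq> Pow (sequences b)"
    by (auto simp: cylinder_def)
  show "recode \<in> space (restrict_space lborel {0..<1}) \<rightarrow> sequences b"
    using recode_in_sequences by blast
  fix X
  assume "X \<in> cylinder b ` lists {..<b}"
  then obtain \<sigma> where X: "X = cylinder b \<sigma>" by blast
  have "recode -` X \<inter> space (restrict_space lborel {0..<1}) = {y \<in> {0..<1}. recode y \<in> cylinder b \<sigma>}"
    by (auto simp: X space_restrict_space)
  then show "recode -` X \<inter> space (restrict_space lborel {0..<1}) \<in> sets (restrict_space lborel {0..<1})"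
    using recode_vimage_cylinder(1)[of \<sigma>] by (auto simp: sets_restrict_space_iff)
qed

lemma cylinder_in_sets: "cylinder b \<sigma> \<in> sets (bernoulli_measure b p)"
proof (cases "\<sigma> \<in> lists {..<b}")
  case True
  then show ?thesis
    unfolding sets_bernoulli_measure by (intro sigma_sets.Basic) blast
next
  case False
  then have "cylinder b \<sigma> = {}"
    by (auto simp: cylinder_def sequences_def in_set_conv_nth lists_eq_set) metis
  then show ?thesis by simp
qed

text \<open>Both measures agree on cylinders, which together with the empty set form an
  intersection-stable generator containing the whole space.\<close>

lemma distr_recode:
  "distr (restrict_space lborel {0..<1}) (bernoulli_measure b p) recode = bernoulli_measure b p"
    (is "?N = ?M")
proof (rule measure_eqI_generator_eq[where E = "insert {} (cylinder b ` lists {..<b})"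
      and \<Omega> = "sequences b" and A = "\<lambda>_. cylinder b []"])
  \<comment> \<open>Two cylinders are nested or disjoint, which is why the empty set is added to the
    generator.\<close>
  have comparable: "cylinder b \<sigma> \<inter> cylinder b \<tau> = {} \<or> cylinder b \<sigma> \<inter> cylinder b \<tau> = cylinder b \<tau>"
    if "length \<sigma> \<le> length \<tau>" for \<sigma> \<tau>
  proof (cases "\<forall>j<length \<sigma>. \<sigma> ! j = \<tau> ! j")
    case True
    then have "cylinder b \<tau> \<subseteq> cylinder b \<sigma>"
      using that by (auto simp: cylinder_def)
    then show ?thesis by blast
  next
    case False
    then obtain j where "j < length \<sigma>" "\<sigma> ! j \<noteq> \<tau> ! j" by blast
    moreover from this that have "j < length \<tau>" by linarith
    ultimately have "cylinder b \<sigma> \<inter> cylinder b \<tau> = {}"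
      by (fastforce simp: cylinder_def)
    then show ?thesis by blast
  qed
  have "cylinder b \<sigma> \<inter> cylinder b \<tau> \<in> insert {} (cylinder b ` lists {..<b})"
    if "\<sigma> \<in> lists {..<b}" "\<tau> \<in> lists {..<b}" for \<sigma> \<tau>
    using comparable[of \<sigma> \<tau>] comparable[of \<tau> \<sigma>] that nat_le_linear[of "length \<sigma>" "length \<tau>"]
    by (metis Int_commute image_eqI insertCI)
  then show "Int_stable (insert {} (cylinder b ` lists {..<b}))"
    unfolding Int_stable_def by blast
  show "insert {} (cylinder b ` lists {..<b}) \<subseteq> Pow (sequences b)"
    by (auto simp: cylinder_def)
  have "sigma_sets (sequences b) (cylinder b ` lists {..<b}) =
      sigma_sets (sequences b) (insert {} (cylinder b ` lists {..<b}))"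
    by (rule sigma_sets_eqI) (auto intro: sigma_sets.Basic sigma_sets.Empty)
  then show "sets ?M = sigma_sets (sequences b) (insert {} (cylinder b ` lists {..<b}))"
    and "sets ?N = sigma_sets (sequences b) (insert {} (cylinder b ` lists {..<b}))"
    by (simp_all add: sets_bernoulli_measure)
  have p_nonneg: "0 \<le> p i" if "i < b" for i
    using p_eq[OF that] by simp
  have eq: "emeasure ?N (cylinder b \<sigma>) = ennreal (\<Prod>j<length \<sigma>. p (\<sigma> ! j))" if "set \<sigma> \<subseteq> {..<b}" for \<sigma>
  proof -
    have "emeasure ?N (cylinder b \<sigma>) = emeasure (restrict_space lborel {0..<1})
        {y \<in> {0..<1}. recode y \<in> cylinder b \<sigma>}"
      using emeasure_distr[OF measurable_recode cylinder_in_sets]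
      by (simp add: space_restrict_space vimage_def Int_def conj_commute)
    also have "\<dots> = emeasure lborel {y \<in> {0..<1}. recode y \<in> cylinder b \<sigma>}"
      by (rule emeasure_restrict_space) auto
    also have "\<dots> = ennreal (\<Prod>j<length \<sigma>. p (\<sigma> ! j))"
      unfolding recode_vimage_cylinder(2)
      using that p_eq by (intro arg_cong[of _ _ ennreal] prod.cong) (auto simp: subset_iff)
    finally show ?thesis .
  qed
  show "emeasure ?N X = emeasure ?M X" if "X \<in> insert {} (cylinder b ` lists {..<b})" for X
    using that eq emeasure_bernoulli_cylinder[OF p_nonneg sum_p] by (auto simp: lists_eq_set)
  show "range (\<lambda>_. cylinder b []) \<subseteq> insert {} (cylinder b ` lists {..<b})"
    by auto
  show "(\<Union>i. cylinder b []) = sequences b"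
    by (auto simp: cylinder_def)
  show "emeasure ?N (cylinder b []) \<noteq> \<infinity>"
    by (simp add: eq)
qed

end

section \<open>Codes of rational intervals\<close>

lemma int_encode_of_nat: "int_encode (int n) = 2 * n"
  by (simp add: int_encode_def sum_encode_def)

text \<open>A rational is coded by the integer codes of a numerator and a denominator;
  \<open>2 * c\<close> is the integer code of the natural number \<open>c\<close>.\<close>

lemma rational_interval_code:
  assumes "c > 0"
  shows "rational_interval (prod_encode (prod_encode (int_encode a, 2 * c), prod_encode (int_encode a', 2 * c))) =
    {of_int a / real c <..< of_int a' / real c} \<inter> {0..1}"
proof -
  have "of_rat (nat_to_rat_surj (prod_encode (int_encode a, 2 * c))) = of_int a / real c" for a
    using assms by (simp add: nat_to_rat_surj_def of_rat_rat flip: int_encode_of_nat)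
  then show ?thesis
    by (simp add: rational_interval_def)
qed

text \<open>A fraction is caught by the test whose level \<open>i\<close> is the interval of radius
  \<open>1 / (c * 2 ^ Suc i)\<close> around it.\<close>

lemma lebesgue_random_not_fraction:
  assumes random: "lebesgue_random x" and "c > 0"
  shows "x \<noteq> real a / real c"
proof
  assume x: "x = real a / real c"
  have x01: "x \<in> {0..1}"
    using random by (simp add: lebesgue_random_def martin_loef_random_def space_restrict_space)
  \<comment> \<open>Numerators of the end points over the common denominator
    \<open>c * 2 ^ Suc i\<close>. The lower one is an integer because it is -1 when
    \<open>a = 0\<close>.\<close>
  define lower where "lower i = int a * 2 ^ Suc i - 1" for i
  define upper where "upper i = int (a * 2 ^ Suc i + 1)" for i
  define h where "h i = prod_encode (prod_encode (int_encode (lower i), 2 * (c * 2 ^ Suc i)),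
    prod_encode (int_encode (upper i), 2 * (c * 2 ^ Suc i)))" for i
  define U where "U i = rational_interval (h i)" for i
  \<comment> \<open>The value 1 is the code of -1; for positive \<open>a\<close> the natural
    subtraction does not truncate.\<close>
  have int_encode_lower: "int_encode (lower i) = (if a = 0 then 1 else 2 * (a * 2 ^ Suc i - 1))" for i
  proof (cases "a = 0")
    case True
    then show ?thesis
      by (simp add: lower_def int_encode_def sum_encode_def)
  next
    case False
    then have "lower i = int (a * 2 ^ Suc i - 1)"
      by (simp add: lower_def of_nat_diff)
    then have "int_encode (lower i) = 2 * (a * 2 ^ Suc i - 1)"
      by (simp only: int_encode_of_nat)
    with False show ?thesis by simp
  qed
  have "computable 1 (\<lambda>xs. h (xs ! 0))"
    unfolding h_def int_encode_lower upper_def int_encode_of_nat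
    by (cases "a = 0"; simp only: if_True if_False)
      (intro computable_prod_encode computable_mult computable_add computable_diff computable_power
        computable_Suc computable_const computable_proj; simp)+
  then have ce: "computably_enumerable 2 {[i, h i] | i. True}"
    by (rule computably_enumerable_graph)
  have U: "U i = {x - 1 / real (c * 2 ^ Suc i) <..< x + 1 / real (c * 2 ^ Suc i)} \<inter> {0..1}" for i
  proof -
    have "U i = {of_int (lower i) / real (c * 2 ^ Suc i) <..< of_int (upper i) / real (c * 2 ^ Suc i)} \<inter> {0..1}"
      unfolding U_def h_def using assms(2) by (intro rational_interval_code) simp
    moreover have "of_int (lower i) / real (c * 2 ^ Suc i) = x - 1 / real (c * 2 ^ Suc i)"
      and "of_int (upper i) / real (c * 2 ^ Suc i) = x + 1 / real (c * 2 ^ Suc i)"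
      using assms(2) by (simp_all add: x lower_def upper_def diff_divide_distrib add_divide_distrib)
    ultimately show ?thesis by (simp only:)
  qed
  have "emeasure (restrict_space lborel {0..1}) (U i) \<le> ennreal ((1 / 2) ^ i)" for i
  proof -
    have "emeasure (restrict_space lborel {0..1}) (U i) = emeasure lborel (U i)"
      unfolding U by (rule emeasure_restrict_space) auto
    also have "\<dots> \<le> emeasure lborel {x - 1 / real (c * 2 ^ Suc i) <..< x + 1 / real (c * 2 ^ Suc i)}"
      unfolding U by (rule emeasure_mono) auto
    also have "\<dots> = ennreal ((1 / real c) * (1 / 2) ^ i)"
      by (subst emeasure_lborel_Ioo) (simp_all add: power_divide)
    also have "\<dots> \<le> ennreal ((1 / 2) ^ i)"
      using assms(2) by (intro ennreal_leI mult_left_le_one_le) auto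
    finally show ?thesis .
  qed
  moreover have "uniformly_effectively_open rational_interval U"
    unfolding uniformly_effectively_open_def
    by (intro exI[of _ "{[i, h i] | i. True}"] conjI ce) (auto simp: U_def)
  ultimately have "x \<notin> (\<Inter>i. U i)"
    using random by (simp add: lebesgue_random_def martin_loef_random_def martin_loef_test_def)
  moreover have "x \<in> U i" for i
    using x01 assms(2) by (simp add: U)
  ultimately show False by blast
qed

section \<open>Pulling back Bernoulli tests\<close>

context digit_recoding
begin

text \<open>The fractions are kept unreduced: the integer codes \<open>2 * K\<close> and
  \<open>2 * d ^ L\<close> can be read off, which makes the code injective in \<open>L\<close> and
  \<open>K\<close>.\<close>

definition block_interval_code :: "nat \<Rightarrow> nat \<Rightarrow> nat" where
  "block_interval_code L K =
     prod_encode (prod_encode (2 * K, 2 * d ^ L), prod_encode (2 * Suc K, 2 * d ^ L))"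

lemma rational_interval_block_interval_code:
  "rational_interval (block_interval_code L K) =
     {real K / real d ^ L <..< real (Suc K) / real d ^ L} \<inter> {0..1}"
  using rational_interval_code[of "d ^ L" "int K" "int (Suc K)"] base
  by (simp only: block_interval_code_def int_encode_of_nat) simp

lemma computable_block_interval_code:
  "computable 2 (\<lambda>xs. block_interval_code (xs ! 0) (xs ! 1))"
  unfolding block_interval_code_def
  by (intro computable_prod_encode computable_mult computable_power computable_Suc computable_const
      computable_proj; simp)

lemma block_interval_code_inject:
  assumes "block_interval_code L K = block_interval_code L' K'"
  shows "L = L' \<and> K = K'"
  using assms base by (simp add: block_interval_code_def power_inject_exp)

text \<open>Supplies the bound by which the search recovers \<open>L\<close> as a remainder:
  \<open>L < 2 ^ L\<close>, and pairing does not decrease its second component.\<close>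

lemma le_block_interval_code: "L \<le> block_interval_code L K"
proof -
  have "L \<le> d ^ L"
    using less_exp[of L] power_mono[of 2 d L] base by linarith
  also have "\<dots> \<le> prod_encode (2 * Suc K, 2 * d ^ L)"
    using le_prod_encode_2[of "2 * d ^ L" "2 * Suc K"] by linarith
  also have "\<dots> \<le> block_interval_code L K"
    unfolding block_interval_code_def by (rule le_prod_encode_2)
  finally show ?thesis .
qed

lemma computable_digit_block:
  "computable 2 (\<lambda>xs. list_encode (digit_block d G (xs ! 0) (xs ! 1)))"
proof -
  \<comment> \<open>Positions 0 and 3 are the iteration counter and \<open>K\<close>. A remainder by
    \<open>d\<close> always passes the test, which only brings \<open>G\<close> into the form of a
    finite table.\<close>
  have "computable 2 (\<lambda>xs. rec_nat 0 (\<lambda>j r.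
      Suc (prod_encode (if (j # r # xs) ! 3 div d ^ (j # r # xs) ! 0 mod d < d
        then G ((j # r # xs) ! 3 div d ^ (j # r # xs) ! 0 mod d) else 0, (j # r # xs) ! 1))) (xs ! 0))"
    by (intro computable_rec computable_Suc computable_prod_encode computable_finite_table
        computable_mod computable_div computable_power computable_const computable_proj; simp)
  then show ?thesis
    using base by (simp add: list_encode_digit_block numeral_3_eq_3)
qed

lemma recode_vimage_block_interval:
  assumes "y \<in> rational_interval (block_interval_code L K)"
  shows "y \<in> {0..<1} \<and> recode y \<in> cylinder b (digit_block d G L K)"
proof -
  have D: "real d ^ L > 0"
    using base by simp
  have y: "real K < y * real d ^ L" "y * real d ^ L < real (Suc K)" "0 \<le> y" "y \<le> 1"
    using assms D by (simp_all add: rational_interval_block_interval_code pos_divide_less_eq pos_less_divide_eq)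
  \<comment> \<open>For \<open>y = 1\<close> the integer \<open>d ^ L\<close> would lie strictly
    between \<open>K\<close> and \<open>K + 1\<close>.\<close>
  have "y \<noteq> 1"
  proof
    assume "y = 1"
    with y have "real K < real (d ^ L)" "real (d ^ L) < real (Suc K)" by simp_all
    then show False
      by (simp only: of_nat_less_iff)
  qed
  with y have "y < 1" by simp
  have "\<lfloor>y * real d ^ L\<rfloor> = int K"
    using y by (simp add: floor_eq_iff)
  then have "recode y \<in> cylinder b (digit_block d G L K)"
    using \<open>y < 1\<close> y by (simp add: recode_in_cylinder_iff)
  with \<open>y < 1\<close> y show ?thesis by simp
qed

text \<open>The integer part places \<open>x\<close> in a half-open interval; avoiding all fractions
  with denominator \<open>d ^ L\<close> rules out its left end.\<close>

lemma recode_in_cylinder_obtains: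
  assumes "recode x \<in> cylinder b \<sigma>" and "x \<in> {0..1}" and "\<And>a L. x \<noteq> real a / real d ^ L"
  obtains L K where "\<sigma> = digit_block d G L K" and "x \<in> rational_interval (block_interval_code L K)"
proof -
  define L where "L = length \<sigma>"
  define K where "K = nat \<lfloor>x * real d ^ L\<rfloor>"
  have D: "real d ^ L > 0"
    using base by simp
  have "x \<noteq> 1"
    using assms(3)[of 1 0] by simp
  then have x: "0 \<le> x" "x < 1"
    using assms(2) by auto
  have "\<sigma> = digit_block d G L K"
    using assms(1) x by (simp add: recode_in_cylinder_iff L_def K_def)
  moreover have "real K \<le> x * real d ^ L" "x * real d ^ L < real (Suc K)"
    using x D by (simp_all add: K_def) linarith
  then have "real K / real d ^ L \<le> x" "x < real (Suc K) / real d ^ L"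
    using D by (simp_all add: pos_divide_le_eq pos_less_divide_eq)
  with assms(3)[of K L] x have "x \<in> rational_interval (block_interval_code L K)"
    by (simp add: rational_interval_block_interval_code)
  ultimately show ?thesis
    by (rule that)
qed

theorem bernoulli_random_recode:
  assumes random: "lebesgue_random x"
  shows "bernoulli_random b p (recode x)"
  unfolding bernoulli_random_def martin_loef_random_def
proof (intro conjI allI impI notI)
  show "recode x \<in> space (bernoulli_measure b p)"
    by (simp add: space_bernoulli_measure recode_in_sequences)
  fix U
  assume "martin_loef_test (bernoulli_measure b p) (\<lambda>n. cylinder b (list_decode n)) U"
    and in_U: "recode x \<in> (\<Inter>i. U i)"
  then obtain W where W: "computably_enumerable 2 W"
    and U: "\<And>i. U i = (\<Union>n\<in>{n. [i, n] \<in> W}. cylinder b (list_decode n))"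
    and le: "\<And>i. emeasure (bernoulli_measure b p) (U i) \<le> ennreal ((1 / 2) ^ i)"
    by (auto simp: martin_loef_test_def uniformly_effectively_open_def)
  let ?e = "\<lambda>L K. list_encode (digit_block d G L K)"
  \<comment> \<open>Level \<open>i\<close> lists the intervals whose recoded block has its code in
    level \<open>i\<close> of the given test.\<close>
  let ?W = "{[i, block_interval_code L K] | i L K. [i, ?e L K] \<in> W}"
  define V where "V i = (\<Union>n\<in>{n. [i, n] \<in> ?W}. rational_interval n)" for i
  have "computably_enumerable 2 ?W"
    by (rule computably_enumerable_image[OF W computable_block_interval_code computable_digit_block
          block_interval_code_inject le_block_interval_code])
  then have open_V: "uniformly_effectively_open rational_interval V"
    unfolding uniformly_effectively_open_def V_def by blast
  have U_sets: "U i \<in> sets (bernoulli_measure b p)" for i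
    unfolding U by (intro sets.countable_UN') (auto simp: cylinder_in_sets)
  \<comment> \<open>An inclusion is enough for the measure bound; equality may fail at the end
    points of the open intervals.\<close>
  have V_subset: "V i \<subseteq> {y \<in> {0..<1}. recode y \<in> U i}" for i
  proof
    fix y
    assume "y \<in> V i"
    then obtain L K where "[i, ?e L K] \<in> W" "y \<in> rational_interval (block_interval_code L K)"
      by (auto simp: V_def)
    with recode_vimage_block_interval[of y L K] show "y \<in> {y \<in> {0..<1}. recode y \<in> U i}"
      unfolding U by fastforce
  qed
  have "emeasure (restrict_space lborel {0..1}) (V i) \<le> ennreal ((1 / 2) ^ i)" for i
  proof -
    have vimage: "recode -` U i \<inter> space (restrict_space lborel {0..<1}) = {y \<in> {0..<1}. recode y \<in> U i}"
      by (auto simp: space_restrict_space)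
    have "recode -` U i \<inter> space (restrict_space lborel {0..<1}) \<in> sets (restrict_space lborel {0..<1})"
      by (rule measurable_sets[OF measurable_recode U_sets])
    then have meas: "{y \<in> {0..<1}. recode y \<in> U i} \<in> sets lborel"
      unfolding vimage by (simp add: sets_restrict_space_iff)
    have "V i \<subseteq> {0..1}"
      by (auto simp: V_def rational_interval_def split: prod.split)
    then have "emeasure (restrict_space lborel {0..1}) (V i) = emeasure lborel (V i)"
      by (intro emeasure_restrict_space) auto
    also have "\<dots> \<le> emeasure lborel {y \<in> {0..<1}. recode y \<in> U i}"
      by (rule emeasure_mono[OF V_subset meas])
    also have "\<dots> = emeasure (restrict_space lborel {0..<1}) {y \<in> {0..<1}. recode y \<in> U i}"
      by (intro emeasure_restrict_space[symmetric]) auto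
    also have "\<dots> = emeasure (distr (restrict_space lborel {0..<1}) (bernoulli_measure b p) recode) (U i)"
      unfolding emeasure_distr[OF measurable_recode U_sets] vimage ..
    also have "\<dots> \<le> ennreal ((1 / 2) ^ i)"
      unfolding distr_recode by (rule le)
    finally show ?thesis .
  qed
  with open_V have "martin_loef_test (restrict_space lborel {0..1}) rational_interval V"
    by (simp add: martin_loef_test_def)
  with random have "x \<notin> (\<Inter>i. V i)" and x: "x \<in> {0..1}"
    by (auto simp: lebesgue_random_def martin_loef_random_def space_restrict_space)
  moreover have "x \<in> V i" for i
  proof -
    obtain n where n: "[i, n] \<in> W" "recode x \<in> cylinder b (list_decode n)"
      using in_U by (auto simp: U)
    \<comment> \<open>The end points missing from \<open>V i\<close> are fractions, hence different
      from \<open>x\<close>.\<close>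
    have "x \<noteq> real a / real d ^ L" for a L
      using lebesgue_random_not_fraction[OF random, of "d ^ L" a] base by simp
    with n(2) x obtain L K where "list_decode n = digit_block d G L K"
      and K: "x \<in> rational_interval (block_interval_code L K)"
      by (rule recode_in_cylinder_obtains)
    then have "n = ?e L K"
      by (metis list_decode_inverse)
    with n(1) K show ?thesis
      unfolding V_def by blast
  qed
  ultimately show False by blast
qed

end

section \<open>The block of repeated digits\<close>

lemma length_filter_concat_replicate:
  "length (filter ((=) c) (concat (map (\<lambda>i. replicate (f i) i) [0..<b]))) = (if c < b then f c else 0)"
proof (induction b)
  case (Suc b)
  then show ?case
    by (cases "c = b") (simp_all add: less_Suc_eq)
qed simp

lemma length_concat_replicate:
  "length (concat (map (\<lambda>i. replicate (f i) i) [0..<b])) = (\<Sum>i<b. f i)"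
  by (induction b) simp_all
theorem theorem3p4:
  fixes x :: real and b d :: nat and p :: "nat \<Rightarrow> rat" and num den :: "nat \<Rightarrow> nat"
    and g :: "nat list" and \<beta> :: "nat \<Rightarrow> nat"
  assumes "x \<in> {0..1}" and "lebesgue_random x"
    and "b \<ge> 2"
    and "\<And>i. i < b \<Longrightarrow> p i > 0" and "(\<Sum>i<b. p i) = 1"
    and "\<And>i. i < b \<Longrightarrow> den i > 0 \<and> coprime (num i) (den i) \<and> p i = of_nat (num i) / of_nat (den i)"
    and "d = Lcm (den ` {..<b})"
    and "g = concat (map (\<lambda>i. replicate (nat \<lfloor>p i * of_nat d\<rfloor>) i) [0..<b])"
    and "\<And>k. \<beta> k = g ! digit_sequence d x k"
  shows "bernoulli_random b (\<lambda>i. of_rat (p i)) \<beta>"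
proof -
  define m where "m i = nat \<lfloor>p i * of_nat d\<rfloor>" for i
  have g: "g = concat (map (\<lambda>i. replicate (m i) i) [0..<b])"
    unfolding m_def by (rule assms(8))
  have "0 \<notin> den ` {..<b}"
    using assms(6) by (metis imageE lessThan_iff less_irrefl)
  then have "d \<noteq> 0"
    unfolding assms(7) by (simp add: Lcm_0_iff)
  \<comment> \<open>\<open>d\<close> is a multiple of each denominator, so \<open>p i * d\<close> is
    a natural number and the floor in \<open>m\<close> is exact.\<close>
  have m: "of_nat (m i) = p i * of_nat d" if "i < b" for i
  proof -
    have "den i dvd d"
      unfolding assms(7) using that by (intro dvd_Lcm) simp
    then obtain q where "d = den i * q" ..
    then have "p i * of_nat d = of_nat (num i * q)"
      using assms(6)[OF that] by simp
    then show ?thesis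
      by (simp only: m_def floor_of_nat nat_int)
  qed
  have m_pos: "m i > 0" if "i < b" for i
    using m[OF that] assms(4)[OF that] \<open>d \<noteq> 0\<close> by (cases "m i = 0") auto
  have "(of_nat (\<Sum>i<b. m i) :: rat) = (\<Sum>i<b. p i) * of_nat d"
    by (simp add: m sum_distrib_right)
  then have sum_m: "(\<Sum>i<b. m i) = d"
    unfolding assms(5) by (metis mult_1 of_nat_eq_iff)
  have len: "length g = d"
    unfolding g length_concat_replicate by (rule sum_m)
  \<comment> \<open>Every digit below \<open>b\<close> occurs in \<open>g\<close>, so the length
    \<open>d\<close> of \<open>g\<close> is at least \<open>b\<close>.\<close>
  have "2 \<le> d"
  proof -
    have "b = (\<Sum>i<b. 1)" by simp
    also have "\<dots> \<le> (\<Sum>i<b. m i)"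
      using m_pos by (intro sum_mono) (simp add: Suc_leI)
    finally show ?thesis
      using assms(3) sum_m by simp
  qed
  have "digit_recoding d b ((!) g) (\<lambda>i. of_rat (p i))"
  proof
    show "2 \<le> d" by fact
    show "g ! r < b" if "r < d" for r
    proof -
      have "g ! r \<in> set g"
        using that len by simp
      moreover have "set g \<subseteq> {..<b}"
        unfolding g by auto
      ultimately show ?thesis by blast
    qed
    \<comment> \<open>The digit \<open>i\<close> fills \<open>m i\<close> of the \<open>d\<close>
      positions of \<open>g\<close>, so a uniformly chosen position carries it with probability
      \<open>p i\<close>.\<close>
    show "of_rat (p i) = real (card {r. r < d \<and> g ! r = i}) / real d" if "i < b" for i
    proof -
      have "card {r. r < d \<and> g ! r = i} = length (filter ((=) i) g)"
        unfolding length_filter_conv_card len by (intro arg_cong[of _ _ card]) auto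
      also have "\<dots> = m i"
        unfolding g length_filter_concat_replicate using that by simp
      finally have "real (card {r. r < d \<and> g ! r = i}) = of_rat (of_nat (m i))"
        by simp
      also have "\<dots> = of_rat (p i) * real d"
        unfolding m[OF that] by (simp add: of_rat_mult)
      finally show ?thesis
        using \<open>d \<noteq> 0\<close> by simp
    qed
    show "(\<Sum>i<b. of_rat (p i)) = (1 :: real)"
      by (simp only: of_rat_sum[symmetric] assms(5) of_rat_1)
  qed
  then interpret digit_recoding d b "(!) g" "\<lambda>i. of_rat (p i)" .
  have "\<beta> = recode x"
    by (intro ext) (simp only: recode_def assms(9))
  then show ?thesis
    by (simp only: bernoulli_random_recode[OF assms(2)])
qed

end
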